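(* Let $n\ge 1$ and let $T:\mathbb{H}^{n}\to\mathbb{H}^{n}$ be bounded and right-$\mathbb{H}$-linear, i.e. $T$ is additive and $T(x\cdot a)=T(x)\cdot a$ for all $x\in\mathbb{H}^{n}$, $a\in\mathbb{H}$. Let $\Phi_{\mathrm{conj}}:\mathbb{H}^n\to\mathbb{H}^n$ be componentwise quaternionic conjugation and define $T^{L}:=\Phi_{\mathrm{conj}}\circ T\circ\Phi_{\mathrm{conj}}$. Then: (i) $T^{L}$ is left-$\mathbb{H}$-linear: $T^{L}(a\cdot y)=a\cdot T^{L}(y)$ for all $y\in\mathbb{H}^{n}$, $a\in\mathbb{H}$. (ii) $\|T^{L}\|_{\mathrm{op}}=\|T\|_{\mathrm{op}}$.
   Context: $\mathbb{H}$ is the skew field of real quaternions $q=q_0+q_1\mathbf i+q_2\mathbf j+q_3\mathbf k$, with conjugate $\bar q=q_0-q_1\mathbf i-q_2\mathbf j-q_3\mathbf k$ and norm $\|q\|^2=q\bar q$. $\mathbb{H}^n$ carries the norm $\|x\|=(\sum_i\|x_i\|^2)^{1/2}$. It is a left module via $(a\cdot x)_i=ax_i$ and a right module via $(x\cdot a)_i=x_ia$. Componentwise conjugation is $\Phi_{\mathrm{conj}}(x)_i=\bar x_i$. The operator norm is $\|T\|_{\mathrm{op}}=\sup_{\|x\|=1}\|T(x)\|$. *)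

theory Defs
  imports "HOL-Analysis.Analysis"
begin

section \<open>The skew field of real quaternions\<close>

datatype quat = Quat (qre: real) (qim1: real) (qim2: real) (qim3: real)

lemma quat_eq_iff:
  "p = q \<longleftrightarrow> qre p = qre q \<and> qim1 p = qim1 q \<and> qim2 p = qim2 q \<and> qim3 p = qim3 q"
  by (cases p; cases q) simp

definition qi :: quat where "qi = Quat 0 1 0 0"
definition qj :: quat where "qj = Quat 0 0 1 0"
definition qk :: quat where "qk = Quat 0 0 0 1"

definition qconj :: "quat \<Rightarrow> quat" where
  "qconj q = Quat (qre q) (- qim1 q) (- qim2 q) (- qim3 q)"

lemma qconj_sel [simp]:
  "qre (qconj q) = qre q" "qim1 (qconj q) = - qim1 q"
  "qim2 (qconj q) = - qim2 q" "qim3 (qconj q) = - qim3 q"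
  by (simp_all add: qconj_def)

instantiation quat :: real_vector
begin

definition zero_quat_def: "0 = Quat 0 0 0 0"
definition plus_quat_def:
  "p + q = Quat (qre p + qre q) (qim1 p + qim1 q) (qim2 p + qim2 q) (qim3 p + qim3 q)"
definition uminus_quat_def: "- q = Quat (- qre q) (- qim1 q) (- qim2 q) (- qim3 q)"
definition minus_quat_def:
  "p - q = Quat (qre p - qre q) (qim1 p - qim1 q) (qim2 p - qim2 q) (qim3 p - qim3 q)"
definition scaleR_quat_def:
  "r *\<^sub>R q = Quat (r * qre q) (r * qim1 q) (r * qim2 q) (r * qim3 q)"

instance
  by standard (simp_all add: zero_quat_def plus_quat_def uminus_quat_def minus_quat_def
      scaleR_quat_def quat_eq_iff algebra_simps)

end

lemma quat_vector_sel [simp]: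
  fixes p q :: quat
  shows "qre 0 = 0" "qim1 0 = 0" "qim2 0 = 0" "qim3 0 = 0"
    and "qre (p + q) = qre p + qre q" "qim1 (p + q) = qim1 p + qim1 q"
        "qim2 (p + q) = qim2 p + qim2 q" "qim3 (p + q) = qim3 p + qim3 q"
    and "qre (- q) = - qre q" "qim1 (- q) = - qim1 q" "qim2 (- q) = - qim2 q" "qim3 (- q) = - qim3 q"
    and "qre (p - q) = qre p - qre q" "qim1 (p - q) = qim1 p - qim1 q"
        "qim2 (p - q) = qim2 p - qim2 q" "qim3 (p - q) = qim3 p - qim3 q"
    and "qre (r *\<^sub>R q) = r * qre q" "qim1 (r *\<^sub>R q) = r * qim1 q"
        "qim2 (r *\<^sub>R q) = r * qim2 q" "qim3 (r *\<^sub>R q) = r * qim3 q"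
  by (simp_all add: zero_quat_def plus_quat_def uminus_quat_def minus_quat_def scaleR_quat_def)

instantiation quat :: real_algebra_1
begin

definition one_quat_def: "1 = Quat 1 0 0 0"
definition times_quat_def:
  "p * q = Quat
    (qre p * qre q - qim1 p * qim1 q - qim2 p * qim2 q - qim3 p * qim3 q)
    (qre p * qim1 q + qim1 p * qre q + qim2 p * qim3 q - qim3 p * qim2 q)
    (qre p * qim2 q - qim1 p * qim3 q + qim2 p * qre q + qim3 p * qim1 q)
    (qre p * qim3 q + qim1 p * qim2 q - qim2 p * qim1 q + qim3 p * qre q)"

instance
  by standard (simp_all add: one_quat_def times_quat_def quat_eq_iff algebra_simps)

end

lemma quat_ring_sel [simp]:
  "qre 1 = 1" "qim1 1 = 0" "qim2 1 = 0" "qim3 1 = 0"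
  "qre (p * q) = qre p * qre q - qim1 p * qim1 q - qim2 p * qim2 q - qim3 p * qim3 q"
  "qim1 (p * q) = qre p * qim1 q + qim1 p * qre q + qim2 p * qim3 q - qim3 p * qim2 q"
  "qim2 (p * q) = qre p * qim2 q - qim1 p * qim3 q + qim2 p * qre q + qim3 p * qim1 q"
  "qim3 (p * q) = qre p * qim3 q + qim1 p * qim2 q - qim2 p * qim1 q + qim3 p * qre q"
  by (simp_all add: one_quat_def times_quat_def)

lemma quat_units:
  "qi * qi = -1" "qj * qj = -1" "qk * qk = -1"
  "qi * qj = qk" "qj * qk = qi" "qk * qi = qj"
  "qj * qi = - qk" "qk * qj = - qi" "qi * qk = - qj"
  by (simp_all add: quat_eq_iff qi_def qj_def qk_def)

lemma of_real_quat_sel [simp]: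
  "qre (of_real r) = r" "qim1 (of_real r) = 0" "qim2 (of_real r) = 0" "qim3 (of_real r) = 0"
  by (simp_all add: of_real_def)

lemma quat_expand:
  "q = of_real (qre q) + of_real (qim1 q) * qi + of_real (qim2 q) * qj + of_real (qim3 q) * qk"
  by (simp add: quat_eq_iff qi_def qj_def qk_def)

lemma quat_sq_sum_eq_0_iff:
  "(qre q)\<^sup>2 + (qim1 q)\<^sup>2 + (qim2 q)\<^sup>2 + (qim3 q)\<^sup>2 = 0 \<longleftrightarrow> q = 0"
  by (simp add: quat_eq_iff add_nonneg_eq_0_iff)

instantiation quat :: real_normed_div_algebra
begin

definition norm_quat_def:
  "norm q = sqrt ((qre q)\<^sup>2 + (qim1 q)\<^sup>2 + (qim2 q)\<^sup>2 + (qim3 q)\<^sup>2)"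

definition inverse_quat_def:
  "inverse q = inverse ((qre q)\<^sup>2 + (qim1 q)\<^sup>2 + (qim2 q)\<^sup>2 + (qim3 q)\<^sup>2) *\<^sub>R qconj q"

definition divide_quat_def: "p div q = p * inverse q" for p q :: quat

definition sgn_quat_def: "sgn q = q /\<^sub>R norm q" for q :: quat

definition dist_quat_def: "dist p q = norm (p - q)" for p q :: quat

definition uniformity_quat_def [code del]:
  "(uniformity :: (quat \<times> quat) filter) = (INF e\<in>{0 <..}. principal {(x, y). dist x y < e})"

definition open_quat_def [code del]:
  "open (U :: quat set) \<longleftrightarrow> (\<forall>x\<in>U. eventually (\<lambda>(x', y). x' = x \<longrightarrow> y \<in> U) uniformity)"

instance
proof
  fix r :: real and p q :: quat and S :: "quat set"
  show "p \<noteq> 0 \<Longrightarrow> inverse p * p = 1" "p \<noteq> 0 \<Longrightarrow> p * inverse p = 1"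
    using quat_sq_sum_eq_0_iff [of p]
    by (simp_all add: quat_eq_iff inverse_quat_def field_simps power2_eq_square)
  show "inverse (0::quat) = 0"
    by (simp add: inverse_quat_def quat_eq_iff)
  show "(norm q = 0) = (q = 0)"
    by (simp add: norm_quat_def quat_sq_sum_eq_0_iff)
  have norm_pair: "norm x = norm ((qre x, qim1 x), (qim2 x, qim3 x))" for x
    by (simp add: norm_quat_def norm_Pair add.assoc)
  show "norm (p + q) \<le> norm p + norm q"
    using norm_triangle_ineq [of "((qre p, qim1 p), (qim2 p, qim3 p))"
        "((qre q, qim1 q), (qim2 q, qim3 q))"]
    by (simp add: norm_pair)
  have "norm (r *\<^sub>R q) = sqrt (r\<^sup>2 * ((qre q)\<^sup>2 + (qim1 q)\<^sup>2 + (qim2 q)\<^sup>2 + (qim3 q)\<^sup>2))"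
    by (simp add: norm_quat_def power_mult_distrib distrib_left)
  then show "norm (r *\<^sub>R q) = \<bar>r\<bar> * norm q"
    by (simp add: norm_quat_def real_sqrt_mult)
  show "norm (p * q) = norm p * norm q"
    unfolding norm_quat_def real_sqrt_mult [symmetric] quat_ring_sel
    by (rule arg_cong [where f = sqrt]) (simp add: power2_eq_square algebra_simps)
qed (rule divide_quat_def sgn_quat_def dist_quat_def open_quat_def uniformity_quat_def)+

end

lemma quat_mult_qconj: "q * qconj q = of_real ((norm q)\<^sup>2)"
  by (simp add: quat_eq_iff norm_quat_def algebra_simps power2_eq_square [of "qre q"]
      power2_eq_square [of "qim1 q"] power2_eq_square [of "qim2 q"] power2_eq_square [of "qim3 q"])


section \<open>Quaternionic coordinate space\<close>

text \<open>
  The space of $n$-tuples is \<^typ>\<open>quat ^ 'n\<close>, with $n$ the cardinality of the finite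
  (necessarily nonempty) type \<^typ>\<open>'n\<close>. Its library norm is the Euclidean one. The left action
  is the library's \<^const>\<open>vector_scalar_mult\<close>, written \<^term>\<open>a *s x\<close>, which multiplies every
  component by \<^term>\<open>a\<close> from the left.
\<close>

definition right_scalar_mult :: "quat ^ 'n \<Rightarrow> quat \<Rightarrow> quat ^ 'n" (infixl "*r" 70) where
  "x *r a = (\<chi> i. x $ i * a)"

definition vec_qconj :: "quat ^ 'n \<Rightarrow> quat ^ 'n" where
  "vec_qconj x = (\<chi> i. qconj (x $ i))"

definition right_H_linear :: "(quat ^ 'n \<Rightarrow> quat ^ 'm) \<Rightarrow> bool" where
  "right_H_linear T \<longleftrightarrow> (\<forall>x y. T (x + y) = T x + T y) \<and> (\<forall>x a. T (x *r a) = T x *r a)"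

definition left_H_linear :: "(quat ^ 'n \<Rightarrow> quat ^ 'm) \<Rightarrow> bool" where
  "left_H_linear T \<longleftrightarrow> (\<forall>x y. T (x + y) = T x + T y) \<and> (\<forall>a x. T (a *s x) = a *s T x)"

definition bounded_operator :: "('a::real_normed_vector \<Rightarrow> 'b::real_normed_vector) \<Rightarrow> bool" where
  "bounded_operator T \<longleftrightarrow> (\<exists>C. \<forall>x. norm (T x) \<le> C * norm x)"

text \<open>
  A supremum of reals, meaningful only for a bounded operator on a nontrivial space. For
  bounded linear maps it agrees with the library's \<^const>\<open>onorm\<close>, a supremum of quotients.
\<close>

definition op_norm :: "('a::real_normed_vector \<Rightarrow> 'b::real_normed_vector) \<Rightarrow> real" where
  "op_norm T = (SUP x\<in>{x. norm x = 1}. norm (T x))"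

lemma op_norm_eq_onorm:
  fixes T :: "'a::{real_normed_vector, perfect_space} \<Rightarrow> 'b::real_normed_vector"
  assumes "bounded_linear T"
  shows "op_norm T = onorm T"
proof (rule antisym)
  interpret bounded_linear T by fact
  obtain z :: 'a where "z \<noteq> 0"
    by (metis UNIV_I UNIV_eq_I not_open_singleton open_UNIV singletonI)
  then have "norm (z /\<^sub>R norm z) = 1" by simp
  then have ne: "{x::'a. norm x = 1} \<noteq> {}" by blast
  have le: "norm (T x) \<le> onorm T" if "norm x = 1" for x
    using onorm [OF assms, of x] that by simp
  show "op_norm T \<le> onorm T"
    unfolding op_norm_def by (rule cSUP_least [OF ne]) (simp add: le)
  have bdd: "bdd_above ((\<lambda>x. norm (T x)) ` {x. norm x = 1})"
    using le by (auto intro!: bdd_aboveI2)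
  have sup: "norm (T x) \<le> op_norm T" if "norm x = 1" for x
    unfolding op_norm_def by (rule cSUP_upper [OF _ bdd]) (simp add: that)
  show "onorm T \<le> op_norm T"
  proof (rule onorm_le)
    fix x
    show "norm (T x) \<le> op_norm T * norm x"
    proof (cases "x = 0")
      case False
      then have "norm (T (x /\<^sub>R norm x)) \<le> op_norm T" by (intro sup) simp
      with False show ?thesis by (simp add: scaleR field_simps)
    qed (simp add: zero)
  qed
qed

definition left_version :: "(quat ^ 'n \<Rightarrow> quat ^ 'n) \<Rightarrow> (quat ^ 'n \<Rightarrow> quat ^ 'n)" where
  "left_version T = vec_qconj \<circ> T \<circ> vec_qconj"

end

theory Submission
  imports Defs
begin

text \<open>
  Quaternionic conjugation is an additive anti-automorphism, so componentwise conjugation swaps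
  the right and the left scalar action, with the scalar itself conjugated (\<open>vec_qconj_scalar_mult\<close>).
  Conjugating a right-linear map on both sides therefore turns right scalars into left ones, and
  the two conjugations of the scalar cancel.

  Componentwise conjugation is also a norm-preserving involution. Hence it permutes the unit
  sphere, and the two operator norms are suprema of the same set of reals.
\<close>

lemma qconj_add: "qconj (p + q) = qconj p + qconj q"
  by (simp add: quat_eq_iff)

lemma qconj_mult: "qconj (p * q) = qconj q * qconj p"
  by (simp add: quat_eq_iff algebra_simps)

lemma qconj_qconj [simp]: "qconj (qconj q) = q"
  by (simp add: quat_eq_iff)

lemma norm_qconj [simp]: "norm (qconj q) = norm q"
  by (simp add: norm_quat_def)

lemma vec_qconj_add: "vec_qconj (x + y) = vec_qconj x + vec_qconj y"
  by (simp add: vec_qconj_def vec_eq_iff qconj_add)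

lemma vec_qconj_vec_qconj [simp]: "vec_qconj (vec_qconj x) = x"
  by (simp add: vec_qconj_def vec_eq_iff)

lemma norm_vec_qconj [simp]: "norm (vec_qconj x) = norm x"
  by (simp add: vec_qconj_def norm_vec_def)

lemma vec_qconj_scalar_mult:
  "vec_qconj (a *s x) = vec_qconj x *r qconj a"
  "vec_qconj (x *r a) = qconj a *s vec_qconj x"
  by (simp_all add: vec_qconj_def right_scalar_mult_def vec_eq_iff qconj_mult)

lemma left_H_linear_left_version:
  assumes "right_H_linear T"
  shows "left_H_linear (left_version T)"
  using assms
  by (simp add: right_H_linear_def left_H_linear_def left_version_def
      vec_qconj_add vec_qconj_scalar_mult)

lemma op_norm_left_version: "op_norm (left_version T) = op_norm T"
proof -
  have sphere: "vec_qconj ` {x. norm x = 1} = {x :: quat ^ 'a. norm x = 1}"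
    by (force intro: image_eqI [where x = "vec_qconj _"])
  have "(\<lambda>x. norm (left_version T x)) ` {x. norm x = 1}
      = (\<lambda>x. norm (T x)) ` vec_qconj ` {x. norm x = 1}"
    by (simp add: left_version_def image_image)
  then show ?thesis
    by (simp add: op_norm_def sphere)
qed

theorem theorem2p1:
  fixes T :: "quat ^ 'n \<Rightarrow> quat ^ 'n"
  assumes "bounded_operator T" and "right_H_linear T"
  shows "left_H_linear (left_version T) \<and> op_norm (left_version T) = op_norm T"
  using assms(2) by (simp add: left_H_linear_left_version op_norm_left_version)

end
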